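(* Let $X$ be a nonempty set, let $D$ be a nonempty subset of $X^*$, and consider a function $F\colon X^*\to\mathrm{ran}(F)$. If $F\in\mathcal{A}_D$, then $F\in\mathcal{P}_D$ and $F$ satisfies $F|_D=F\circ F|_D$ (that is, $F(F(\mathbf{y}))=F(\mathbf{y})$ for every $\mathbf{y}\in D$). The converse also holds whenever $F(D)\subseteq D$: if $F(D)\subseteq D$, $F\in\mathcal{P}_D$ and $F|_D=F\circ F|_D$, then $F\in\mathcal{A}_D$.
   Context: For a nonempty set $X$, $X^*=\bigcup_{n\geqslant 0}X^n$ is the set of all finite strings (tuples) over $X$, including the empty string $\varepsilon$ ($X^0=\{\varepsilon\}$), endowed with concatenation, written by juxtaposition, with neutral element $\varepsilon$. $\mathrm{ran}(F)$ denotes the range of $F$, which is an arbitrary set (not assumed to be contained in $X^*$). For a nonempty $D\subseteq X^*$: $\mathcal{A}_D$ is the class of functions $F\colon X^*\to\mathrm{ran}(F)$ such that $F(D)\subseteq X^*$ and $F(\mathbf{x}\mathbf{y}\mathbf{z})=F(\mathbf{x}F(\mathbf{y})\mathbf{z})$ for all $\mathbf{x},\mathbf{y},\mathbf{z}\in X^*$ with $\mathbf{y}\in D$. $\mathcal{P}_D$ is the class of functions $F\colon X^*\to\mathrm{ran}(F)$ such that for all $\mathbf{x},\mathbf{y},\mathbf{y}',\mathbf{z}\in X^*$ with $\mathbf{y},\mathbf{y}'\in D$, $F(\mathbf{y})=F(\mathbf{y}')$ implies $F(\mathbf{x}\mathbf{y}\mathbf{z})=F(\mathbf{x}\mathbf{y}'\mathbf{z})$.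 *)

theory Defs
  imports Main
begin

text \<open>
  Strings over \<open>X\<close> are the lists in \<^term>\<open>lists X\<close>, and concatenation is append.
  The range of \<open>F\<close> is an arbitrary set that may or may not meet the set of strings over \<open>X\<close>.
  This is modelled by the codomain \<^typ>\<open>'a list + 'b\<close>: a value \<open>Inl s\<close> with \<open>s \<in> lists X\<close>
  is the string \<open>s\<close>, and any other value is an object that is not a string over \<open>X\<close>.
  Only the values of \<open>F\<close> on \<^term>\<open>lists X\<close> matter; those elsewhere are never constrained.
\<close>

text \<open>
  The first conjunct is the inclusion of \<open>F(D)\<close> in the set of strings over \<open>X\<close>; it ensures
  that \<^const>\<open>projl\<close> is only used to read off an actual string.
\<close>

definition assoc_class :: "'a set \<Rightarrow> 'a list set \<Rightarrow> ('a list \<Rightarrow> 'a list + 'b) set" where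
  "assoc_class X D = {F. F ` D \<subseteq> Inl ` lists X \<and>
     (\<forall>x\<in>lists X. \<forall>y\<in>D. \<forall>z\<in>lists X. F (x @ y @ z) = F (x @ projl (F y) @ z))}"

definition preassoc_class :: "'a set \<Rightarrow> 'a list set \<Rightarrow> ('a list \<Rightarrow> 'a list + 'b) set" where
  "preassoc_class X D = {F. \<forall>x\<in>lists X. \<forall>y\<in>D. \<forall>y'\<in>D. \<forall>z\<in>lists X.
     F y = F y' \<longrightarrow> F (x @ y @ z) = F (x @ y' @ z)}"

text \<open>
  The equation \<open>F|\<^sub>D = F \<circ> F|\<^sub>D\<close>. The composite exists only if \<open>F\<close> maps \<open>D\<close> into the strings
  over \<open>X\<close>, so this is part of the condition.
\<close>

definition idempotent_on :: "'a set \<Rightarrow> 'a list set \<Rightarrow> ('a list \<Rightarrow> 'a list + 'b) \<Rightarrow> bool" where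
  "idempotent_on X D F \<longleftrightarrow> F ` D \<subseteq> Inl ` lists X \<and> (\<forall>y\<in>D. F (projl (F y)) = F y)"

end

theory Submission
  imports Defs
begin

text \<open>Associativity lets a factor \<open>y\<close> in \<open>D\<close> be replaced by the
  string \<open>F y\<close> in any context. Hence the value on a word depends on \<open>y\<close>
  only through \<open>F y\<close>, which is preassociativity; the empty context gives idempotence.
  Conversely, idempotence says that \<open>y\<close> and the string \<open>F y\<close> have the same
  image, so once that string lies in \<open>D\<close>, preassociativity exchanges the two in every
  context.\<close>

lemma assoc_class_imp_preassoc_class:
  assumes "F \<in> assoc_class X D"
  shows "F \<in> preassoc_class X D"
proof -
  have *: "F (x @ y @ z) = F (x @ projl (F y) @ z)"
    if "x \<in> lists X" "y \<in> D" "z \<in> lists X" for x y z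
    using assms that unfolding assoc_class_def by blast
  show ?thesis
    unfolding preassoc_class_def
  proof (intro CollectI ballI impI)
    fix x y y' z
    assume "x \<in> lists X" "y \<in> D" "y' \<in> D" "z \<in> lists X" "F y = F y'"
    \<comment> \<open>Both sides equal \<open>F (x @ projl (F y) @ z)\<close>.\<close>
    then show "F (x @ y @ z) = F (x @ y' @ z)"
      by (metis *)
  qed
qed

lemma assoc_class_imp_idempotent_on:
  assumes "F \<in> assoc_class X D"
  shows "idempotent_on X D F"
proof -
  have "F (projl (F y)) = F y" if "y \<in> D" for y
  proof -
    \<comment> \<open>Empty context on both sides.\<close>
    have "F ([] @ y @ []) = F ([] @ projl (F y) @ [])"
      using assms that unfolding assoc_class_def by blast
    then show ?thesis by simp
  qed
  then show ?thesis
    using assms by (simp add: assoc_class_def idempotent_on_def)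
qed

text \<open>Preassociativity only compares members of \<open>D\<close>; the first assumption makes
  \<open>projl (F y)\<close> an admissible partner for \<open>y\<close>.\<close>

lemma preassoc_idempotent_imp_assoc_class:
  assumes "F ` D \<subseteq> Inl ` D" and "F \<in> preassoc_class X D" and "idempotent_on X D F"
  shows "F \<in> assoc_class X D"
proof -
  have "F (x @ y @ z) = F (x @ projl (F y) @ z)"
    if "x \<in> lists X" "y \<in> D" "z \<in> lists X" for x y z
  proof -
    have "projl (F y) \<in> D"
    proof -
      have "F y \<in> Inl ` D"
        using assms(1) that(2) by (rule subsetD [OF _ imageI])
      then show ?thesis by (elim imageE) simp
    qed
    moreover have "F y = F (projl (F y))"
      using assms(3) that(2) by (simp add: idempotent_on_def)
    \<comment> \<open>Preassociativity with \<open>projl (F y)\<close> as \<open>y'\<close>.\<close>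
    ultimately show ?thesis
      using assms(2) that unfolding preassoc_class_def by blast
  qed
  \<comment> \<open>That \<open>F\<close> maps \<open>D\<close> into strings over \<open>X\<close>
    is the first conjunct of \<open>idempotent_on\<close>.\<close>
  then show ?thesis
    using assms(3) by (simp add: assoc_class_def idempotent_on_def)
qed

theorem proposition3p2:
  fixes X :: "'a set" and D :: "'a list set" and F :: "'a list \<Rightarrow> 'a list + 'b"
  assumes "X \<noteq> {}" and "D \<noteq> {}" and "D \<subseteq> lists X"
  shows "(F \<in> assoc_class X D \<longrightarrow> F \<in> preassoc_class X D \<and> idempotent_on X D F) \<and>
    (F ` D \<subseteq> Inl ` D \<and> F \<in> preassoc_class X D \<and> idempotent_on X D F \<longrightarrow> F \<in> assoc_class X D)"
  by (intro conjI impI; (elim conjE)?)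
    (rule assoc_class_imp_preassoc_class assoc_class_imp_idempotent_on
      preassoc_idempotent_imp_assoc_class; assumption)+

end
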